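(* Let $A\in\mathbb{R}^{N\times N}$, where $N$ is regarded as arbitrarily large, have singular values $\sigma_1\ge\sigma_2\ge\dots$ satisfying $\sigma_j=O(e^{-\alpha j})$ for some $\alpha>0$, and let $b\in\mathbb{R}^N$, $b\ne 0$. Let $h_{i+1,i}$ ($i\ge 1$) be the subdiagonal entries of the Hessenberg matrices produced by the Arnoldi algorithm applied to $A$ and $b$. Then, for $m\to\infty$, $$\left(\prod_{i=1}^{m}h_{i+1,i}\right)^{1/m}\le k\,e^{-\frac{m\alpha}{e^{2}}+\frac{\alpha+2}{2}+O\left(\frac{1}{m}\right)},$$ where $k$ is a constant independent of $m$.
   Context: The Arnoldi algorithm applied to $A$ and $b$ builds (in exact arithmetic) an orthonormal basis $w_1,\dots,w_m$ of the Krylov subspace $\mathcal{K}_m(A,b)=\mathrm{span}\{b,Ab,\dots,A^{m-1}b\}$, starting from $w_1=b/\|b\|$ and orthonormalizing $Aw_j$ against $w_1,\dots,w_j$ at each step to obtain $w_{j+1}$. With $W_m=[w_1,\dots,w_m]$ it satisfies $AW_m=W_mH_m+h_{m+1,m}w_{m+1}e_m^T$, where $H_m=(h_{i,j})\in\mathbb{R}^{m\times m}$ is upper Hessenberg, $h_{i,j}=w_i^TAw_j$, $h_{j+1,j}\ge 0$, and $e_m=(0,\dots,0,1)^T\in\mathbb{R}^m$; the process terminates when $h_{m+1,m}=0$. The norm is the Euclidean norm. Since $N$ is regarded as arbitrarily large, the asymptotics are understood as follows: the constant implied in $\sigma_j=O(e^{-\alpha j})$ does not depend on $j$ or $N$,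 and $k$ and the constant implied in $O(1/m)$ do not depend on $m$ or $N$. In the exponents, $e$ is Euler's number. *)

theory Defs
  imports
    Complex_Main
    "HOL-Library.Landau_Symbols"
    "Jordan_Normal_Form.Char_Poly"
begin

definition vec_norm2 :: "real vec \<Rightarrow> real" where
  "vec_norm2 v = sqrt (v \<bullet> v)"

(* Since 1 / 0 = 0, the zero vector is mapped to the zero vector. *)
definition vec_unit :: "real vec \<Rightarrow> real vec" where
  "vec_unit v = (1 / vec_norm2 v) \<cdot>\<^sub>v v"

(* For a real N x N matrix, transpose_mat A * A is symmetric, so its characteristic polynomial
   splits over the reals and this list has length N. *)
definition singular_values :: "real mat \<Rightarrow> real list" where
  "singular_values A =
     rev (sorted_list_of_multiset (image_mset sqrt (proots (char_poly (transpose_mat A * A)))))"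

(* Singular values are numbered from 1, the largest one first; j is meant to range over 1..N. *)
definition singular_value :: "real mat \<Rightarrow> nat \<Rightarrow> real" where
  "singular_value A j = singular_values A ! (j - 1)"

(* If the columns of W are orthonormal, W * transpose_mat W is the orthogonal projection onto
   their span. *)
definition orth_residual :: "real vec list \<Rightarrow> real vec \<Rightarrow> real vec" where
  "orth_residual ws v =
     (let W = mat_of_cols (dim_vec v) ws in v - W *\<^sub>v (transpose_mat W *\<^sub>v v))"

(* arnoldi A b m is the list [w_1, ..., w_m].  The algorithm terminates at the first step j at
   which the residual vanishes, i.e. h_{j+1,j} = 0.  To have a total function, the sequence is
   continued from there by zero vectors, so that h_{i+1,i} = 0 for all i >= j. *)
fun arnoldi :: "real mat \<Rightarrow> real vec \<Rightarrow> nat \<Rightarrow> real vec list" where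
  "arnoldi A b 0 = []"
| "arnoldi A b (Suc 0) = [vec_unit b]"
| "arnoldi A b (Suc (Suc j)) =
     (let ws = arnoldi A b (Suc j)
      in ws @ [vec_unit (orth_residual ws (A *\<^sub>v last ws))])"

definition arnoldi_vec :: "real mat \<Rightarrow> real vec \<Rightarrow> nat \<Rightarrow> real vec" where
  "arnoldi_vec A b j = arnoldi A b j ! (j - 1)"

definition hessenberg :: "real mat \<Rightarrow> real vec \<Rightarrow> nat \<Rightarrow> nat \<Rightarrow> real" where
  "hessenberg A b i j = arnoldi_vec A b i \<bullet> (A *\<^sub>v arnoldi_vec A b j)"

end

(* If all h_(i+1,i) are nonzero, their product is the determinant of the compression U^T A W, where
   W = [w_1, ..., w_m] and U = [w_2, ..., w_(m+1)]: this matrix is upper triangular since A w_j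
   lies in the span of w_1, ..., w_(j+1).  Multiplying W by an orthogonal matrix T changes the
   determinant at most by its sign, and T can be chosen such that, for each j < m, some column of
   W T is orthogonal to the first j right singular vectors of A, so that A maps it to a vector of
   norm at most sigma_(j+1).  The Leibniz formula then gives
   |det (U^T A W)| <= m! sigma_1 ... sigma_m.  Because of the decay of the sigma_j the m-th root of
   the right-hand side is O(m exp (-alpha m / 2)); since 1/e^2 < 1/4, the crude factor m! is
   harmless and the O(1/m) term can be taken to be 0. *)
theory Submission
  imports Defs
begin

section \<open>Unit vectors and orthogonality in real coordinate space\<close>

lemma scalar_prod_self_nonneg: "(0::real) \<le> v \<bullet> v"
  unfolding scalar_prod_def by (rule sum_nonneg) simp

lemma scalar_prod_self_eq_0_iff:
  fixes v :: "real vec"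
  assumes "v \<in> carrier_vec n"
  shows "v \<bullet> v = 0 \<longleftrightarrow> v = 0\<^sub>v n"
  using assms by (auto simp: scalar_prod_def sum_nonneg_eq_0_iff intro!: eq_vecI)

lemma scalar_prod_vec_unit:
  assumes v: "v \<in> carrier_vec n" and v0: "v \<noteq> 0\<^sub>v n"
  shows "vec_unit v \<in> carrier_vec n" "vec_unit v \<bullet> vec_unit v = 1"
proof -
  have pos: "v \<bullet> v > 0"
    using scalar_prod_self_eq_0_iff[OF v] v0 scalar_prod_self_nonneg[of v] by linarith
  show "vec_unit v \<in> carrier_vec n" using v by (simp add: vec_unit_def)
  have "vec_unit v \<bullet> vec_unit v = (1 / vec_norm2 v)\<^sup>2 * (v \<bullet> v)"
    using v by (simp add: vec_unit_def power2_eq_square)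
  also have "\<dots> = 1" using pos by (simp add: vec_norm2_def power_divide)
  finally show "vec_unit v \<bullet> vec_unit v = 1" .
qed

text \<open>The residual of \<open>y\<close> after projection onto \<open>u\<close> has squared norm
  \<open>y \<bullet> y\<close> minus the square of \<open>u \<bullet> y\<close>, and this is
  nonnegative.\<close>

lemma scalar_prod_le_unit:
  fixes u y :: "real vec"
  assumes u: "u \<in> carrier_vec n" and y: "y \<in> carrier_vec n" and unit: "u \<bullet> u = 1"
  shows "(u \<bullet> y)\<^sup>2 \<le> y \<bullet> y"
proof -
  let ?c = "u \<bullet> y"
  have "0 \<le> (y - ?c \<cdot>\<^sub>v u) \<bullet> (y - ?c \<cdot>\<^sub>v u)" by (rule scalar_prod_self_nonneg)
  also have "\<dots> = y \<bullet> y - ?c\<^sup>2"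
    using u y unit comm_scalar_prod[OF u y]
    by (simp add: minus_scalar_prod_distrib[of _ n]
      scalar_prod_minus_distrib[of _ n] power2_eq_square algebra_simps)
  finally show ?thesis by simp
qed

text \<open>Fewer than \<open>n\<close> linear conditions on \<open>n\<close> unknowns have a
  nonzero common solution, which is then normalised. All later existence arguments (extension of
  orthonormal lists, the dimension bound, the adapted basis) reduce to this count.\<close>

lemma ex_unit_orthogonal:
  fixes vs :: "real vec list"
  assumes vs: "set vs \<subseteq> carrier_vec n" and len: "length vs < n"
  shows "\<exists>u \<in> carrier_vec n. u \<bullet> u = 1 \<and> (\<forall>v\<in>set vs. v \<bullet> u = 0)"
proof -
  \<comment> \<open>Padding the conditions with zero rows gives a square matrix. Its row
    \<open>length vs\<close> is zero, so it is singular and has a nontrivial kernel.\<close>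
  define M where "M = mat n n (\<lambda>(i, j). if i < length vs then vs ! i $ j else 0)"
  have M: "M \<in> carrier_mat n n" by (simp add: M_def)
  have "det M = 0"
  proof -
    have "row M (length vs) = 0\<^sub>v n" using len by (intro eq_vecI) (auto simp: M_def)
    then have "transpose_mat M *\<^sub>v unit_vec n (length vs) = 0\<^sub>v n"
      using len M by (intro eq_vecI) (auto simp: M_def)
    then have "det (transpose_mat M) = 0"
      using M len by (subst det_0_iff_vec_prod_zero[of _ n])
        (auto intro!: exI[of _ "unit_vec n (length vs)"])
    then show ?thesis using det_transpose[OF M] by simp
  qed
  then obtain w where w: "w \<in> carrier_vec n" "w \<noteq> 0\<^sub>v n" "M *\<^sub>v w = 0\<^sub>v n"
    using det_0_iff_vec_prod_zero[OF M] by auto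
  have "v \<bullet> w = 0" if "v \<in> set vs" for v
  proof -
    from that obtain i where i: "i < length vs" "v = vs ! i" by (auto simp: in_set_conv_nth)
    have "vs ! i \<in> carrier_vec n" using i vs by auto
    then have "row M i = v" using i len by (intro eq_vecI) (auto simp: M_def)
    moreover have "(M *\<^sub>v w) $ i = row M i \<bullet> w" using i len M by simp
    ultimately show ?thesis using w i len by simp
  qed
  then have "v \<bullet> vec_unit w = 0" if "v \<in> set vs" for v
    using that vs w(1) by (auto simp: vec_unit_def)
  then show ?thesis using scalar_prod_vec_unit[OF w(1,2)] by blast
qed

section \<open>Orthonormal lists\<close>

text \<open>The condition on inner products only sees the set of entries, so distinctness is what
  excludes repetitions. Speaking of entries instead of indices makes the notion invariant under
  reordering, as needed when an eigenbasis is sorted by eigenvalue.\<close>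

definition orthonormal :: "nat \<Rightarrow> real vec list \<Rightarrow> bool" where
  "orthonormal n vs \<longleftrightarrow> set vs \<subseteq> carrier_vec n \<and> distinct vs \<and>
     (\<forall>u\<in>set vs. \<forall>v\<in>set vs. u \<bullet> v = (if u = v then 1 else 0))"

lemma orthonormal_carrier: "orthonormal n vs \<Longrightarrow> i < length vs \<Longrightarrow> vs ! i \<in> carrier_vec n"
  by (auto simp: orthonormal_def)

lemma orthonormal_nth:
  "orthonormal n vs \<Longrightarrow> i < length vs \<Longrightarrow> j < length vs \<Longrightarrow>
    vs ! i \<bullet> vs ! j = (if i = j then 1 else 0)"
  by (auto simp: orthonormal_def nth_eq_iff_index_eq)

lemma orthonormal_mset_cong:
  "mset vs = mset ws \<Longrightarrow> orthonormal n vs \<longleftrightarrow> orthonormal n ws"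
  unfolding orthonormal_def using mset_eq_setD mset_eq_imp_distinct_iff by metis

lemma orthonormal_take: "orthonormal n vs \<Longrightarrow> orthonormal n (take k vs)"
  unfolding orthonormal_def
proof (intro conjI ballI)
  assume a: "set vs \<subseteq> carrier_vec n \<and> distinct vs \<and>
    (\<forall>u\<in>set vs. \<forall>v\<in>set vs. u \<bullet> v = (if u = v then 1 else 0))"
  show "set (take k vs) \<subseteq> carrier_vec n" "distinct (take k vs)"
    using a set_take_subset[of k vs] by auto
  fix u v assume "u \<in> set (take k vs)" "v \<in> set (take k vs)"
  then have "u \<in> set vs" "v \<in> set vs" by (auto dest: in_set_takeD)
  with a show "u \<bullet> v = (if u = v then 1 else 0)" by blast
qed

lemma orthonormal_tl: "orthonormal n vs \<Longrightarrow> orthonormal n (tl vs)"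
  by (cases vs) (auto simp: orthonormal_def)

lemma orthonormal_snoc:
  assumes "orthonormal n vs" "u \<in> carrier_vec n" "u \<bullet> u = 1" "\<forall>v\<in>set vs. v \<bullet> u = 0"
  shows "orthonormal n (vs @ [u])"
proof -
  have "u \<bullet> v = 0" if "v \<in> set vs" for v
    using assms that comm_scalar_prod[of u n v] by (auto simp: orthonormal_def)
  with assms show ?thesis by (auto simp: orthonormal_def)
qed

lemma orthonormal_extend:
  assumes "orthonormal n vs" "length vs \<le> n"
  shows "\<exists>us. orthonormal n (vs @ us) \<and> length (vs @ us) = n"
  using assms
proof (induction "n - length vs" arbitrary: vs)
  case 0
  then show ?case by (intro exI[of _ "[]"]) auto
next
  case (Suc k)
  then have "length vs < n" by simp
  with Suc.prems obtain u where u: "u \<in> carrier_vec n" "u \<bullet> u = 1" "\<forall>v\<in>set vs. v \<bullet> u = 0"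
    using ex_unit_orthogonal[of vs n] by (auto simp: orthonormal_def)
  have "\<exists>us. orthonormal n ((vs @ [u]) @ us) \<and> length ((vs @ [u]) @ us) = n"
    using Suc.hyps(2) orthonormal_snoc[OF Suc.prems(1) u] \<open>length vs < n\<close>
    by (intro Suc.hyps(1)) auto
  then obtain us where "orthonormal n (vs @ u # us) \<and> length (vs @ u # us) = n" by auto
  then show ?case by blast
qed

lemma orthonormal_transpose_mult:
  assumes "orthonormal n vs"
  shows "transpose_mat (mat_of_cols n vs) * mat_of_cols n vs = 1\<^sub>m (length vs)"
  using orthonormal_carrier[OF assms] orthonormal_nth[OF assms]
  by (intro eq_matI) auto

text \<open>If there were more than \<open>n\<close> vectors, the \<open>n\<close> rows of the
  matrix with these columns would have a common orthogonal unit vector \<open>t\<close>. Then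
  \<open>?W\<close> kills \<open>t\<close>, although \<open>transpose_mat ?W * ?W\<close> is the
  identity.\<close>

lemma orthonormal_length_le:
  assumes vs: "orthonormal n vs"
  shows "length vs \<le> n"
proof (rule ccontr)
  let ?W = "mat_of_cols n vs"
  assume "\<not> length vs \<le> n"
  then have "length (rows ?W) < length vs" by simp
  moreover have "set (rows ?W) \<subseteq> carrier_vec (length vs)"
    by (auto simp: rows_def)
  ultimately obtain t where t: "t \<in> carrier_vec (length vs)" "t \<bullet> t = 1"
    "\<forall>r\<in>set (rows ?W). r \<bullet> t = 0" using ex_unit_orthogonal by blast
  have "?W *\<^sub>v t = 0\<^sub>v n" using t by (intro eq_vecI) (auto simp: rows_def)
  then have "(transpose_mat ?W * ?W) *\<^sub>v t = 0\<^sub>v (length vs)"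
    using t(1) by (subst assoc_mult_mat_vec[of _ "length vs" n _ "length vs"]) auto
  then show False using t orthonormal_transpose_mult[OF vs] by auto
qed

section \<open>Spectral theorem for real symmetric matrices\<close>

text \<open>The scalar product here is bilinear, without conjugation. The general coefficient type
  allows the use for both the real matrix and its complexification.\<close>

lemma symmetric_scalar_prod:
  assumes "G \<in> carrier_mat n n" "transpose_mat G = (G :: 'a :: comm_semiring_0 mat)"
    "x \<in> carrier_vec n" "y \<in> carrier_vec n"
  shows "y \<bullet> (G *\<^sub>v x) = (G *\<^sub>v y) \<bullet> x"
  using transpose_vec_mult_scalar[OF assms(1,3,4)] assms(2) by simp

text \<open>Over the complex numbers the characteristic polynomial has a root. Symmetry forces this
  root to be real, so it is already a root of the real characteristic polynomial and has a real
  eigenvector.\<close>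

lemma symmetric_ex_unit_eigenvector:
  fixes G :: "real mat"
  assumes G: "G \<in> carrier_mat n n" and sym: "transpose_mat G = G" and n: "n > 0"
  shows "\<exists>v e. v \<in> carrier_vec n \<and> v \<bullet> v = 1 \<and> G *\<^sub>v v = e \<cdot>\<^sub>v v"
proof -
  let ?G = "map_mat complex_of_real G"
  have CG: "?G \<in> carrier_mat n n" using G by simp
  have csym: "transpose_mat ?G = ?G" 
    using arg_cong[OF sym, of "map_mat complex_of_real"] by (simp add: map_mat_transpose)
  obtain as where as: "char_poly ?G = (\<Prod>a\<leftarrow>as. [:- a, 1:])" "length as = n"
    using char_poly_factorized[OF CG] by blast
  then obtain l where "poly (char_poly ?G) l = 0"
    using n by (cases as) auto
  then obtain z where z: "z \<in> carrier_vec n" "z \<noteq> 0\<^sub>v n" "?G *\<^sub>v z = l \<cdot>\<^sub>v z"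
    using eigenvalue_root_char_poly[OF CG] CG by (auto simp: eigenvalue_def eigenvector_def)
  let ?z = "conjugate z"
  have cz: "?z \<in> carrier_vec n" using z by simp
  have Gz: "?G *\<^sub>v ?z = cnj l \<cdot>\<^sub>v ?z"
  proof -
    have "?G *\<^sub>v ?z = conjugate (?G *\<^sub>v z)"
      using G z(1) by (intro eq_vecI) (auto simp: scalar_prod_def)
    then show ?thesis unfolding z(3) by (simp add: conjugate_smult_vec)
  qed
  have "z \<bullet> ?z \<noteq> 0" using conjugate_square_eq_0_vec[OF z(1)] z(2) by simp
  \<comment> \<open>Both sides are the bilinear form of \<open>z\<close> and \<open>?z\<close> under
    \<open>?G\<close>, with \<open>?G\<close> applied to one factor or to the other.\<close>
  moreover have "cnj l * (z \<bullet> ?z) = l * (z \<bullet> ?z)"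
    using symmetric_scalar_prod[OF CG csym cz z(1)] z Gz cz by simp
  ultimately have "cnj l = l" by simp
  then obtain r where r: "l = complex_of_real r" by (metis Reals_cnj_iff Reals_cases)
  have "poly (map_poly complex_of_real (char_poly G)) (complex_of_real r) = 0"
    using \<open>poly (char_poly ?G) l = 0\<close> r of_real_hom.char_poly_hom[OF G] by metis
  then have "poly (char_poly G) r = 0" by simp
  then obtain v where v: "v \<in> carrier_vec n" "v \<noteq> 0\<^sub>v n" "G *\<^sub>v v = r \<cdot>\<^sub>v v"
    using eigenvalue_root_char_poly[OF G] G by (auto simp: eigenvalue_def eigenvector_def)
  have "G *\<^sub>v vec_unit v = r \<cdot>\<^sub>v vec_unit v"
    unfolding vec_unit_def using v G
    by (subst mult_mat_vec[of _ n n]) (auto simp: smult_smult_assoc mult.commute)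
  then show ?thesis using scalar_prod_vec_unit[OF v(1,2)] by blast
qed

text \<open>Deflation: split off one unit eigenvector \<open>v\<close>, compress \<open>G\<close> to
  the orthogonal complement of \<open>v\<close>, and lift an eigenbasis of the smaller symmetric
  matrix back by the isometry \<open>?U\<close>.\<close>

lemma symmetric_eigenbasis:
  fixes G :: "real mat"
  assumes "G \<in> carrier_mat n n" and "transpose_mat G = G"
  shows "\<exists>qs. orthonormal n qs \<and> length qs = n \<and> (\<forall>q\<in>set qs. \<exists>e. G *\<^sub>v q = e \<cdot>\<^sub>v q)"
  using assms
proof (induction n arbitrary: G)
  case 0
  then show ?case by (intro exI[of _ "[]"]) (auto simp: orthonormal_def)
next
  case (Suc n)
  note G = Suc.prems(1) and sym = Suc.prems(2)
  obtain v e where v: "v \<in> carrier_vec (Suc n)" "v \<bullet> v = 1" "G *\<^sub>v v = e \<cdot>\<^sub>v v"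
    using symmetric_ex_unit_eigenvector[OF G sym] by auto
  have "orthonormal (Suc n) [v]" using v by (simp add: orthonormal_def)
  from orthonormal_extend[OF this] obtain us
    where on: "orthonormal (Suc n) (v # us)" and len: "length us = n" by auto
  have us: "orthonormal (Suc n) us" using on by (auto simp: orthonormal_def)
  let ?W = "mat_of_cols (Suc n) (v # us)"
  let ?U = "mat_of_cols (Suc n) us"
  have U: "?U \<in> carrier_mat (Suc n) n" using len by auto
  have UU: "transpose_mat ?U * ?U = 1\<^sub>m n" using orthonormal_transpose_mult[OF us] len by simp
  have Uv: "u \<bullet> v = 0" if "u \<in> set us" for u using on that by (auto simp: orthonormal_def)
  have Uy: "v \<bullet> (?U *\<^sub>v y) = 0" if "y \<in> carrier_vec n" for y
  proof -
    have "transpose_mat ?U *\<^sub>v v = 0\<^sub>v n"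
      using len Uv orthonormal_carrier[OF us] by (intro eq_vecI) auto
    then show ?thesis using transpose_vec_mult_scalar[OF U that v(1)] that by simp
  qed
  \<comment> \<open>The range of \<open>?U\<close> is all of the orthogonal complement of
    \<open>v\<close>: the residual \<open>?r\<close> is orthogonal to every column of the square
    orthogonal matrix \<open>?W\<close>, hence zero.\<close>
  have Ucomp: "x = ?U *\<^sub>v (transpose_mat ?U *\<^sub>v x)"
    if x: "x \<in> carrier_vec (Suc n)" and vx: "v \<bullet> x = 0" for x
  proof -
    let ?r = "x - ?U *\<^sub>v (transpose_mat ?U *\<^sub>v x)"
    have c: "transpose_mat ?U *\<^sub>v x \<in> carrier_vec n" using U x by auto
    have r: "?r \<in> carrier_vec (Suc n)" using U x by auto
    have "transpose_mat ?U *\<^sub>v ?r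
        = transpose_mat ?U *\<^sub>v x - (transpose_mat ?U * ?U) *\<^sub>v (transpose_mat ?U *\<^sub>v x)"
      using U x c by (subst assoc_mult_mat_vec[of _ n "Suc n" _ n])
        (auto intro!: mult_minus_distrib_mat_vec)
    then have Ur: "transpose_mat ?U *\<^sub>v ?r = 0\<^sub>v n" using UU c by auto
    have vr: "v \<bullet> ?r = 0" using vx Uy[OF c] v x U
      by (subst scalar_prod_minus_distrib[of _ "Suc n"]) auto
    have "transpose_mat ?W *\<^sub>v ?r = 0\<^sub>v (Suc n)"
    proof (intro eq_vecI)
      fix i assume "i < dim_vec (0\<^sub>v (Suc n) :: real vec)"
      then have i: "i < Suc n" by simp
      show "(transpose_mat ?W *\<^sub>v ?r) $ i = 0\<^sub>v (Suc n) $ i"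
      proof (cases i)
        case 0
        then show ?thesis using vr v len by simp
      next
        case (Suc j)
        then have j: "j < n" using i by simp
        have "(transpose_mat ?U *\<^sub>v ?r) $ j = us ! j \<bullet> ?r"
          using j len orthonormal_carrier[OF us, of j] by simp
        then show ?thesis using Ur Suc i j len orthonormal_carrier[OF us, of j] by simp
      qed
    qed (use len in auto)
    moreover have "?W * transpose_mat ?W = 1\<^sub>m (Suc n)"
      using orthonormal_transpose_mult[OF on] len
      by (subst mat_mult_left_right_inverse[of _ "Suc n"]) auto
    moreover have "(?W * transpose_mat ?W) *\<^sub>v ?r = ?W *\<^sub>v (transpose_mat ?W *\<^sub>v ?r)"
      by (rule assoc_mult_mat_vec[of _ "Suc n" "Suc n" _ "Suc n"]) (use r len in auto)
    moreover have "?W *\<^sub>v 0\<^sub>v (Suc n) = 0\<^sub>v (Suc n)"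
      using len by (intro eq_vecI) (auto simp: scalar_prod_def)
    ultimately have r0: "?r = 0\<^sub>v (Suc n)" using r by (metis one_mult_mat_vec)
    show ?thesis
    proof (intro eq_vecI)
      fix i assume "i < dim_vec (?U *\<^sub>v (transpose_mat ?U *\<^sub>v x))"
      then have "i < Suc n" by simp
      then show "x $ i = (?U *\<^sub>v (transpose_mat ?U *\<^sub>v x)) $ i"
        using arg_cong[OF r0, of "\<lambda>w. w $ i"] x by simp
    qed (use x in auto)
  qed
  let ?H = "transpose_mat ?U * G * ?U"
  have H: "?H \<in> carrier_mat n n" using U G by auto
  have "transpose_mat ?H = ?H"
    using U G sym by (simp add: transpose_mult[of _ n "Suc n" _ n]
      transpose_mult[of _ n "Suc n" _ "Suc n"]
      transpose_mult[of _ "Suc n" "Suc n" _ n])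
  from Suc.IH[OF H this] obtain ys where ys: "orthonormal n ys" "length ys = n"
    "\<forall>q\<in>set ys. \<exists>e. ?H *\<^sub>v q = e \<cdot>\<^sub>v q" by blast
  have ysc: "y \<in> carrier_vec n" if "y \<in> set ys" for y
    using that ys(1) by (auto simp: orthonormal_def)
  have iso: "(?U *\<^sub>v x) \<bullet> (?U *\<^sub>v y) = x \<bullet> y" if "x \<in> carrier_vec n" "y \<in> carrier_vec n" for x y
  proof -
    have "(?U *\<^sub>v x) \<bullet> (?U *\<^sub>v y) = (transpose_mat ?U *\<^sub>v (?U *\<^sub>v x)) \<bullet> y"
      using transpose_vec_mult_scalar[OF U that(2), of "?U *\<^sub>v x"] that U by simp
    also have "transpose_mat ?U *\<^sub>v (?U *\<^sub>v x) = (transpose_mat ?U * ?U) *\<^sub>v x"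
      using U that by (subst assoc_mult_mat_vec[of _ n "Suc n" _ n]) auto
    finally show ?thesis using UU that by simp
  qed
  have inj: "x = y" if "x \<in> carrier_vec n" "y \<in> carrier_vec n" "?U *\<^sub>v x = ?U *\<^sub>v y" for x y
  proof -
    have "(transpose_mat ?U * ?U) *\<^sub>v x = (transpose_mat ?U * ?U) *\<^sub>v y"
      using U that by (simp add: assoc_mult_mat_vec[of _ n "Suc n" _ n])
    then show ?thesis using UU that by simp
  qed
  let ?qs = "v # map ((*\<^sub>v) ?U) ys"
  have "orthonormal (Suc n) ?qs"
  proof -
    have "distinct (map ((*\<^sub>v) ?U) ys)"
      using ys(1) inj ysc by (auto simp: distinct_map orthonormal_def inj_on_def)
    moreover have "(?U *\<^sub>v x) \<bullet> (?U *\<^sub>v y) = (if ?U *\<^sub>v x = ?U *\<^sub>v y then 1 else 0)"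
      if xy: "x \<in> set ys" "y \<in> set ys" for x y
    proof -
      have "?U *\<^sub>v x = ?U *\<^sub>v y \<longleftrightarrow> x = y" using inj[OF ysc ysc, OF xy] by blast
      then show ?thesis
        using iso[OF ysc ysc, OF xy] ys(1) xy unfolding orthonormal_def by metis
    qed
    moreover have "set (map ((*\<^sub>v) ?U) ys) \<subseteq> carrier_vec (Suc n)"
      using U ysc by (auto simp del: mat_of_cols_carrier)
    ultimately have "orthonormal (Suc n) (map ((*\<^sub>v) ?U) ys)"
      unfolding orthonormal_def by simp
    moreover have "u \<bullet> v = 0" if u: "u \<in> set (map ((*\<^sub>v) ?U) ys)" for u
    proof -
      obtain y where y: "y \<in> set ys" "u = ?U *\<^sub>v y"
        using u by auto
      have "u \<in> carrier_vec (Suc n)"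
        unfolding y(2) by (rule mult_mat_vec_carrier[OF U ysc[OF y(1)]])
      then show ?thesis
        unfolding y(2) using Uy[OF ysc[OF y(1)]] comm_scalar_prod[OF v(1), of "?U *\<^sub>v y"] by metis
    qed
    ultimately have "orthonormal (Suc n) (map ((*\<^sub>v) ?U) ys @ [v])"
      using v(1,2) by (intro orthonormal_snoc) auto
    \<comment> \<open>The list was built with \<open>v\<close> at the end; orthonormality does not
      depend on the order.\<close>
    moreover have "mset ?qs = mset (map ((*\<^sub>v) ?U) ys @ [v])" by simp
    ultimately show ?thesis using orthonormal_mset_cong by blast
  qed
  moreover have "\<exists>e. G *\<^sub>v (?U *\<^sub>v y) = e \<cdot>\<^sub>v (?U *\<^sub>v y)" if hy: "y \<in> set ys" for y
  proof -
    obtain f where f: "?H *\<^sub>v y = f \<cdot>\<^sub>v y" using ys(3) hy by blast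
    have y: "y \<in> carrier_vec n" using ysc[OF hy] .
    have x: "G *\<^sub>v (?U *\<^sub>v y) \<in> carrier_vec (Suc n)" using G U y by auto
    \<comment> \<open>The complement of \<open>v\<close> is invariant under \<open>G\<close> because
      \<open>v\<close> is an eigenvector and \<open>G\<close> is symmetric. By \<open>Ucomp\<close>,
      applying \<open>G\<close> to a vector in the range of \<open>?U\<close> therefore amounts to
      applying \<open>?H\<close> to its coordinates.\<close>
    have "v \<bullet> (G *\<^sub>v (?U *\<^sub>v y)) = 0"
      using symmetric_scalar_prod[OF G sym _ v(1), of "?U *\<^sub>v y"] v Uy[OF y] U y by simp
    from Ucomp[OF x this] have "G *\<^sub>v (?U *\<^sub>v y) = ?U *\<^sub>v (transpose_mat ?U *\<^sub>v (G *\<^sub>v (?U *\<^sub>v y)))" .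
    also have "transpose_mat ?U *\<^sub>v (G *\<^sub>v (?U *\<^sub>v y)) = ?H *\<^sub>v y"
      using G U y by (simp add: assoc_mult_mat_vec[of _ n "Suc n" _ n]
        assoc_mult_mat_vec[of _ n "Suc n" _ "Suc n"] assoc_mult_mat[of _ n "Suc n" _ "Suc n" _ n])
    also have "?U *\<^sub>v (?H *\<^sub>v y) = f \<cdot>\<^sub>v (?U *\<^sub>v y)" unfolding f using U y by (rule mult_mat_vec)
    finally show ?thesis by blast
  qed
  then have "\<forall>q\<in>set ?qs. \<exists>e. G *\<^sub>v q = e \<cdot>\<^sub>v q"
    using v(3) by (simp only: list.set set_map ball_simps) blast
  moreover have "length ?qs = Suc n" using ys(2) by simp
  ultimately show ?case by (intro exI[of _ ?qs] conjI)
qed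

section \<open>Singular values and right singular vectors\<close>

text \<open>Connects the singular values, defined by roots of a characteristic polynomial with
  multiplicity, with an eigenbasis: \<open>G\<close> is similar to the diagonal matrix of the
  eigenvalues.\<close>

lemma eigenbasis_char_poly:
  fixes G :: "real mat"
  assumes G: "G \<in> carrier_mat n n" and qs: "orthonormal n qs" "length qs = n" "length es = n"
    and ev: "\<And>i. i < n \<Longrightarrow> G *\<^sub>v qs ! i = es ! i \<cdot>\<^sub>v qs ! i"
  defines "Q \<equiv> mat_of_cols n qs"
  shows "proots (char_poly G) = mset es"
    and "transpose_mat Q * G * Q = mat n n (\<lambda>(i, j). if i = j then es ! i else 0)"
proof -
  let ?D = "mat n n (\<lambda>(i, j). if i = j then es ! i else 0)"
  have Q: "Q \<in> carrier_mat n n" using qs by (auto simp: Q_def)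
  have QQ: "transpose_mat Q * Q = 1\<^sub>m n"
    using orthonormal_transpose_mult[OF qs(1)] qs(2) by (simp add: Q_def)
  have QQ': "Q * transpose_mat Q = 1\<^sub>m n" using Q QQ by (subst mat_mult_left_right_inverse[of _ "n"]) auto
  have qc: "qs ! i \<in> carrier_vec n" if "i < n" for i
    using orthonormal_carrier[OF qs(1)] qs(2) that by simp
  show D: "transpose_mat Q * G * Q = ?D"
  proof (intro eq_matI)
    fix i j assume "i < dim_row ?D" "j < dim_col ?D"
    then have ij: "i < n" "j < n" by auto
    have "(transpose_mat Q * G * Q) $$ (i, j) = (transpose_mat Q * (G * Q)) $$ (i, j)"
      using Q G by (simp add: assoc_mult_mat[of _ n n _ n _ n])
    also have "\<dots> = qs ! i \<bullet> (G *\<^sub>v qs ! j)"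
      using ij qs(2) Q G qc col_mult2[OF G Q ij(2)] by (simp add: Q_def)
    also have "\<dots> = ?D $$ (i, j)"
      using ij ev[OF ij(2)] orthonormal_nth[OF qs(1), of i j] qs(2)
        scalar_prod_smult_distrib[OF qc qc, OF ij, of "es ! j"] by simp
    finally show "(transpose_mat Q * G * Q) $$ (i, j) = ?D $$ (i, j)" .
  qed (use Q in auto)
  have "Q * ?D * transpose_mat Q = (Q * transpose_mat Q) * G * (Q * transpose_mat Q)"
    unfolding D[symmetric] using Q G
    by (simp add: assoc_mult_mat[of _ n n _ n _ n])
  then have "G = Q * ?D * transpose_mat Q" using QQ' G by simp
  then have "similar_mat_wit G ?D Q (transpose_mat Q)"
    using G Q QQ QQ' by (auto simp: similar_mat_wit_def)
  then have "char_poly G = char_poly ?D"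
    by (intro char_poly_similar) (auto simp: similar_mat_def)
  also have "\<dots> = (\<Prod>a\<leftarrow>diag_mat ?D. [:- a, 1:])"
    by (intro char_poly_upper_triangular[of _ n]) (auto intro!: upper_triangularI)
  also have "diag_mat ?D = es" using qs(3) by (intro nth_equalityI) (auto simp: diag_mat_def)
  finally have "char_poly G = (\<Prod>a\<leftarrow>es. [:- a, 1:])" .
  moreover have "proots (\<Prod>a\<leftarrow>es. [:- a, 1:]) = mset es"
  proof (induction es)
    case (Cons a es)
    have "(\<Prod>a\<leftarrow>es. [:- a, 1:]) \<noteq> 0" by (auto simp: prod_list_zero_iff)
    then have "proots ([:- a, 1:] * (\<Prod>a\<leftarrow>es. [:- a, 1:])) = proots [:- a, 1:] + mset es"
      using Cons.IH by (subst proots_mult) auto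
    then show ?case by simp
  qed simp
  ultimately show "proots (char_poly G) = mset es" by simp
qed

lemma diagonal_quadratic_form:
  fixes y :: "real vec"
  assumes y: "y \<in> carrier_vec n"
  shows "y \<bullet> (mat n n (\<lambda>(i, j). if i = j then e i else 0) *\<^sub>v y) = (\<Sum>i<n. e i * (y $ i)\<^sup>2)"
proof -
  have "(mat n n (\<lambda>(i, j). if i = j then e i else 0) *\<^sub>v y) $ i = e i * y $ i" if i: "i < n" for i
  proof -
    have "row (mat n n (\<lambda>(i, j). if i = j then e i else 0)) i = e i \<cdot>\<^sub>v unit_vec n i"
      using i by (intro eq_vecI) auto
    then show ?thesis
      using i smult_scalar_prod_distrib[OF unit_vec_carrier y, of "e i" i]
        scalar_prod_left_unit[OF y i] by simp
  qed
  then show ?thesis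
    unfolding scalar_prod_def[of y]
    by (auto simp: power2_eq_square atLeast0LessThan intro!: sum.cong)
qed

text \<open>One half of the Courant-Fischer principle. The \<open>qs\<close> are right singular
  vectors, that is eigenvectors of \<open>transpose_mat A * A\<close>, in order of decreasing
  eigenvalue. Their indices start at 0 while singular values are numbered from 1, so orthogonality
  to the first \<open>j\<close> of them leaves the value with number \<open>Suc j\<close>.\<close>

lemma singular_value_bound:
  fixes A :: "real mat"
  assumes A: "A \<in> carrier_mat n n"
  shows "\<exists>qs. orthonormal n qs \<and> length qs = n \<and>
    (\<forall>j<n. 0 \<le> singular_value A (Suc j) \<and>
      (\<forall>x\<in>carrier_vec n. (\<forall>i<j. qs ! i \<bullet> x = 0) \<longrightarrow>
        (A *\<^sub>v x) \<bullet> (A *\<^sub>v x) \<le> (singular_value A (Suc j))\<^sup>2 * (x \<bullet> x)))"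
proof -
  let ?G = "transpose_mat A * A"
  have G: "?G \<in> carrier_mat n n" using A by auto
  have sym: "transpose_mat ?G = ?G" using A by (simp add: transpose_mult[of _ n n _ n])
  have quad: "x \<bullet> (?G *\<^sub>v x) = (A *\<^sub>v x) \<bullet> (A *\<^sub>v x)" if "x \<in> carrier_vec n" for x
    using transpose_vec_mult_scalar[of "transpose_mat A" n n "A *\<^sub>v x" x] A that
    by (simp add: assoc_mult_mat_vec[of _ n n _ n])
  obtain qs0 where qs0: "orthonormal n qs0" "length qs0 = n"
    "\<forall>q\<in>set qs0. \<exists>e. ?G *\<^sub>v q = e \<cdot>\<^sub>v q"
    using symmetric_eigenbasis[OF G sym] by blast
  \<comment> \<open>On a unit eigenvector this Rayleigh quotient is the eigenvalue, so it can serve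
    as the sort key.\<close>
  define ev where "ev q = q \<bullet> (?G *\<^sub>v q)" for q
  define qs where "qs = rev (sort_key ev qs0)"
  define es where "es = map ev qs"
  have ms: "mset qs = mset qs0" by (simp add: qs_def)
  have qs: "orthonormal n qs" "length qs = n"
    using qs0 orthonormal_mset_cong[OF ms] mset_eq_length[OF ms] by auto
  have qc: "qs ! i \<in> carrier_vec n" if "i < n" for i
    using orthonormal_carrier[OF qs(1)] qs(2) that by simp
  have eig: "?G *\<^sub>v qs ! i = es ! i \<cdot>\<^sub>v qs ! i" if i: "i < n" for i
  proof -
    have "qs ! i \<in> set qs0" using i qs(2) mset_eq_setD[OF ms] nth_mem[of i qs] by simp
    then obtain e where e: "?G *\<^sub>v qs ! i = e \<cdot>\<^sub>v qs ! i" using qs0(3) by blast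
    then have "ev (qs ! i) = e"
      unfolding ev_def using qc[OF i] orthonormal_nth[OF qs(1), of i i] qs(2) i by simp
    then show ?thesis using e i qs(2) by (simp add: es_def)
  qed
  have es: "length es = n" using qs(2) by (simp add: es_def)
  have roots: "proots (char_poly ?G) = mset es"
    by (rule eigenbasis_char_poly(1)[OF G qs es eig])
  have diag: "transpose_mat (mat_of_cols n qs) * ?G * mat_of_cols n qs
      = mat n n (\<lambda>(i, j). if i = j then es ! i else 0)"
    by (rule eigenbasis_char_poly(2)[OF G qs es eig])
  have es0: "es ! i \<ge> 0" if "i < n" for i
    using that quad[OF qc[OF that]] scalar_prod_self_nonneg qs(2) by (simp add: es_def ev_def)
  have sorted: "sorted (rev es)" by (simp add: es_def qs_def rev_map)
  have "singular_values A = rev (sort (map sqrt es))"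
  proof -
    have "image_mset sqrt (proots (char_poly ?G)) = mset (map sqrt es)" using roots by simp
    then show ?thesis unfolding singular_values_def by (simp only: sorted_list_of_multiset_mset)
  qed
  \<comment> \<open>Since \<open>sqrt\<close> is monotone, taking roots preserves the order, and
    position \<open>j\<close> of the sorted singular values belongs to
    \<open>qs ! j\<close>.\<close>
  also have "sort (map sqrt es) = map sqrt (rev es)"
  proof (rule properties_for_sort)
    show "sorted (map sqrt (rev es))"
      by (rule sorted_map_mono[OF sorted]) (auto intro!: mono_onI)
  qed (simp flip: rev_map)
  finally have sv: "singular_value A (Suc j) = sqrt (es ! j)" if "j < n" for j
    using that es by (simp add: singular_value_def rev_map)
  have mono: "es ! i \<le> es ! j" if "j \<le> i" "i < n" for i j
    using sorted_rev_nth_mono[OF sorted that(1)] that es by simp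
  let ?Q = "mat_of_cols n qs"
  have Q: "?Q \<in> carrier_mat n n" using qs by auto
  have QQ: "?Q * transpose_mat ?Q = 1\<^sub>m n" using orthonormal_transpose_mult[OF qs(1)] qs(2)
    by (subst mat_mult_left_right_inverse[of _ "n"]) auto
  have "(A *\<^sub>v x) \<bullet> (A *\<^sub>v x) \<le> es ! j * (x \<bullet> x)"
    if j: "j < n" and x: "x \<in> carrier_vec n" and orth: "\<forall>i<j. qs ! i \<bullet> x = 0" for j x
  proof -
    let ?y = "transpose_mat ?Q *\<^sub>v x"
    have y: "?y \<in> carrier_vec n" using Q x by auto
    have xy: "x = ?Q *\<^sub>v ?y"
      using Q QQ x by (subst assoc_mult_mat_vec[of _ n n _ n, symmetric]) auto
    have yi: "?y $ i = qs ! i \<bullet> x" if "i < n" for i using that qs(2) qc by simp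
    have "x \<bullet> (?G *\<^sub>v x) = (?Q *\<^sub>v ?y) \<bullet> (?G *\<^sub>v (?Q *\<^sub>v ?y))" using xy by simp
    also have "\<dots> = ?y \<bullet> (transpose_mat ?Q *\<^sub>v (?G *\<^sub>v (?Q *\<^sub>v ?y)))"
      using transpose_vec_mult_scalar[of "transpose_mat ?Q" n n "?G *\<^sub>v (?Q *\<^sub>v ?y)" ?y] Q G y by simp
    also have "transpose_mat ?Q *\<^sub>v (?G *\<^sub>v (?Q *\<^sub>v ?y)) = (transpose_mat ?Q * ?G * ?Q) *\<^sub>v ?y"
      using Q G y by (simp add: assoc_mult_mat_vec[of _ n n _ n])
    also have "?y \<bullet> \<dots> = (\<Sum>i<n. es ! i * (?y $ i)\<^sup>2)"
      unfolding diag by (rule diagonal_quadratic_form[OF y])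
    \<comment> \<open>Coordinates with index below \<open>j\<close> vanish by orthogonality; for the
      others the eigenvalue is at most \<open>es ! j\<close>.\<close>
    also have "\<dots> \<le> (\<Sum>i<n. es ! j * (?y $ i)\<^sup>2)"
    proof (rule sum_mono)
      fix i assume "i \<in> {..<n}"
      then show "es ! i * (?y $ i)\<^sup>2 \<le> es ! j * (?y $ i)\<^sup>2"
        using orth yi mono[of j i] by (cases "i < j") (auto intro!: mult_right_mono)
    qed
    also have "\<dots> = es ! j * (?y \<bullet> ?y)"
      unfolding scalar_prod_def[of ?y] carrier_vecD[OF y] sum_distrib_left atLeast0LessThan
      by (simp add: power2_eq_square)
    also have "?y \<bullet> ?y = x \<bullet> x"
      using transpose_vec_mult_scalar[of "transpose_mat ?Q" n n x ?y] Q x y xy by simp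
    finally show ?thesis using quad[OF x] by simp
  qed
  then show ?thesis using qs sv es0 by (intro exI[of _ qs]) simp
qed

section \<open>The determinant of a compression of \<open>A\<close>\<close>

text \<open>Each of the m! Leibniz terms contains exactly one entry from every column, so its
  absolute value is at most the product of the column bounds.\<close>

lemma abs_det_le_fact_mult_prod:
  fixes M :: "real mat"
  assumes M: "M \<in> carrier_mat m m"
    and c: "\<And>i j. i < m \<Longrightarrow> j < m \<Longrightarrow> \<bar>M $$ (i, j)\<bar> \<le> c j"
  shows "\<bar>det M\<bar> \<le> fact m * (\<Prod>j<m. c j)"
proof -
  let ?P = "{p. p permutes {0..<m}}"
  have "\<bar>det M\<bar> \<le> (\<Sum>p\<in>?P. \<bar>signof p * (\<Prod>i = 0..<m. M $$ (i, p i))\<bar>)"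
    unfolding det_def'[OF M] by (rule sum_abs)
  also have "\<dots> \<le> (\<Sum>p\<in>?P. \<Prod>j<m. c j)"
  proof (rule sum_mono)
    fix p assume "p \<in> ?P"
    then have p: "p permutes {0..<m}" by simp
    have "\<bar>signof p * (\<Prod>i = 0..<m. M $$ (i, p i))\<bar> = (\<Prod>i = 0..<m. \<bar>M $$ (i, p i)\<bar>)"
      by (cases p rule: sign_cases) (simp_all add: abs_mult abs_prod)
    also have "\<dots> \<le> (\<Prod>i = 0..<m. c (p i))"
      using c permutes_in_image[OF p] by (intro prod_mono) auto
    also have "\<dots> = (\<Prod>j = 0..<m. c j)"
      using prod.permute[OF p, of c] by (simp add: o_def)
    finally show "\<bar>signof p * (\<Prod>i = 0..<m. M $$ (i, p i))\<bar> \<le> (\<Prod>j<m. c j)"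
      by (simp add: atLeast0LessThan)
  qed
  also have "\<dots> = fact m * (\<Prod>j<m. c j)"
    by (simp add: card_permutations[OF refl])
  finally show ?thesis .
qed

lemma abs_det_orthogonal:
  fixes T :: "real mat"
  assumes T: "T \<in> carrier_mat m m" and TT: "transpose_mat T * T = 1\<^sub>m m"
  shows "\<bar>det T\<bar> = 1"
proof -
  have "det T * det T = 1"
    using det_mult[of "transpose_mat T" m T] T TT det_transpose[OF T] by simp
  then show ?thesis by (auto simp: square_eq_1_iff)
qed

text \<open>Greedy choice with the most restrictive vector first: vector number \<open>j\<close>
  must be orthogonal to its \<open>j\<close> predecessors and to \<open>m - Suc j\<close> of the
  \<open>p i\<close>. These are always m - 1 conditions in dimension m.\<close>

lemma ex_orthonormal_adapted:
  assumes p: "\<And>i. i < m \<Longrightarrow> p i \<in> carrier_vec m" and k: "k \<le> m"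
  shows "\<exists>ts. orthonormal m ts \<and> length ts = k \<and> (\<forall>j<k. \<forall>i<m - Suc j. p i \<bullet> ts ! j = 0)"
  using k
proof (induction k)
  case 0
  then show ?case by (intro exI[of _ "[]"]) (auto simp: orthonormal_def)
next
  case (Suc k)
  then obtain ts where ts: "orthonormal m ts" "length ts = k"
    "\<forall>j<k. \<forall>i<m - Suc j. p i \<bullet> ts ! j = 0" by auto
  let ?vs = "ts @ map p [0..<m - Suc k]"
  have "set ?vs \<subseteq> carrier_vec m" using ts(1) p by (auto simp: orthonormal_def)
  moreover have "length ?vs < m" using ts(2) Suc.prems by simp
  ultimately obtain u where u: "u \<in> carrier_vec m" "u \<bullet> u = 1" "\<forall>v\<in>set ?vs. v \<bullet> u = 0"
    using ex_unit_orthogonal by blast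
  have "orthonormal m (ts @ [u])" using u by (intro orthonormal_snoc[OF ts(1)]) auto
  moreover have "\<forall>j<Suc k. \<forall>i<m - Suc j. p i \<bullet> (ts @ [u]) ! j = 0"
    using ts(2,3) u(3) by (auto simp: nth_append less_Suc_eq)
  ultimately show ?case using ts(2) by (intro exI[of _ "ts @ [u]"]) auto
qed

lemma abs_det_compression_le:
  fixes A :: "real mat"
  assumes A: "A \<in> carrier_mat n n"
    and us: "orthonormal n us" "length us = m" and ws: "orthonormal n ws" "length ws = m"
  shows "\<bar>det (mat m m (\<lambda>(i, j). us ! i \<bullet> (A *\<^sub>v ws ! j)))\<bar>
    \<le> fact m * (\<Prod>j<m. singular_value A (Suc j))"
proof -
  let ?M = "mat m m (\<lambda>(i, j). us ! i \<bullet> (A *\<^sub>v ws ! j))"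
  define W where "W = mat_of_cols n ws"
  have W: "W \<in> carrier_mat n m" using ws(2) by (auto simp: W_def)
  have WW: "transpose_mat W * W = 1\<^sub>m m"
    using orthonormal_transpose_mult[OF ws(1)] ws(2) by (simp add: W_def)
  have uc: "us ! i \<in> carrier_vec n" if "i < m" for i
    using orthonormal_carrier[OF us(1)] us(2) that by simp
  have wc: "ws ! i \<in> carrier_vec n" if "i < m" for i
    using orthonormal_carrier[OF ws(1)] ws(2) that by simp
  have mn: "m \<le> n" using orthonormal_length_le[OF ws(1)] ws(2) by simp
  obtain qs where qs: "orthonormal n qs" "length qs = n"
    and sv: "\<And>j. j < n \<Longrightarrow> 0 \<le> singular_value A (Suc j)"
    and bound: "\<And>j x. j < n \<Longrightarrow> x \<in> carrier_vec n \<Longrightarrow> (\<forall>i<j. qs ! i \<bullet> x = 0) \<Longrightarrow>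
      (A *\<^sub>v x) \<bullet> (A *\<^sub>v x) \<le> (singular_value A (Suc j))\<^sup>2 * (x \<bullet> x)"
    using singular_value_bound[OF A] by metis
  have qc: "qs ! i \<in> carrier_vec n" if "i < n" for i
    using orthonormal_carrier[OF qs(1)] qs(2) that by simp
  have "transpose_mat W *\<^sub>v (qs ! i) \<in> carrier_vec m" if "i < m" for i
    using W qc[of i] mn that by (intro mult_mat_vec_carrier[of _ m n]) auto
  \<comment> \<open>Moving \<open>W\<close> across the scalar product turns these conditions on
    \<open>ts ! j\<close> into orthogonality of \<open>W\<close> applied to \<open>ts ! j\<close> to
    the first \<open>m - Suc j\<close> right singular vectors.\<close>
  from ex_orthonormal_adapted[of m "\<lambda>i. transpose_mat W *\<^sub>v (qs ! i)", OF this order_refl]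
  obtain ts where ts: "orthonormal m ts" "length ts = m"
    and tq: "\<forall>j<m. \<forall>i<m - Suc j. (transpose_mat W *\<^sub>v (qs ! i)) \<bullet> ts ! j = 0" by blast
  define T where "T = mat_of_cols m ts"
  have T: "T \<in> carrier_mat m m" using ts(2) by (auto simp: T_def)
  have TT: "transpose_mat T * T = 1\<^sub>m m"
    using orthonormal_transpose_mult[OF ts(1)] ts(2) by (simp add: T_def)
  have tc: "ts ! j \<in> carrier_vec m" if "j < m" for j
    using orthonormal_carrier[OF ts(1)] ts(2) that by simp
  have M: "?M \<in> carrier_mat m m" by simp
  have entry: "(?M * T) $$ (i, j) = us ! i \<bullet> (A *\<^sub>v (W *\<^sub>v ts ! j))" if ij: "i < m" "j < m" for i j
  proof -
    have x: "W *\<^sub>v ts ! j \<in> carrier_vec n" using W tc[OF ij(2)] by (rule mult_mat_vec_carrier)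
    let ?y = "transpose_mat A *\<^sub>v us ! i"
    have y: "?y \<in> carrier_vec n" using A uc[OF ij(1)] by (intro mult_mat_vec_carrier[of _ n n]) auto
    have "row ?M i = transpose_mat W *\<^sub>v ?y"
    proof (intro eq_vecI)
      fix l assume "l < dim_vec (transpose_mat W *\<^sub>v ?y)"
      then have l: "l < m" using W by simp
      have "row ?M i $ l = us ! i \<bullet> (A *\<^sub>v ws ! l)" using ij l by simp
      also have "\<dots> = ?y \<bullet> ws ! l"
        using transpose_vec_mult_scalar[OF A wc[OF l] uc[OF ij(1)]] by simp
      also have "\<dots> = ws ! l \<bullet> ?y" using y wc[OF l] by (rule comm_scalar_prod)
      also have "\<dots> = (transpose_mat W *\<^sub>v ?y) $ l"
        using l W ws(2) wc[OF l] by (simp add: W_def)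
      finally show "row ?M i $ l = (transpose_mat W *\<^sub>v ?y) $ l" .
    qed (use W in auto)
    moreover have "col T j = ts ! j" using ij(2) ts(2) tc[OF ij(2)] by (simp add: T_def)
    ultimately have "(?M * T) $$ (i, j) = (transpose_mat W *\<^sub>v ?y) \<bullet> ts ! j"
      using ij T by simp
    also have "\<dots> = ?y \<bullet> (W *\<^sub>v ts ! j)"
      using transpose_vec_mult_scalar[OF W tc[OF ij(2)] y] by simp
    also have "\<dots> = us ! i \<bullet> (A *\<^sub>v (W *\<^sub>v ts ! j))"
      using transpose_vec_mult_scalar[OF A x uc[OF ij(1)]] by simp
    finally show ?thesis .
  qed
  have "\<bar>(?M * T) $$ (i, j)\<bar> \<le> singular_value A (Suc (m - Suc j))" if ij: "i < m" "j < m" for i j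
  proof -
    let ?x = "W *\<^sub>v ts ! j"
    have x: "?x \<in> carrier_vec n" using W tc[OF ij(2)] by (rule mult_mat_vec_carrier)
    have "transpose_mat W *\<^sub>v ?x = (transpose_mat W * W) *\<^sub>v ts ! j"
      using W tc[OF ij(2)] by (simp add: assoc_mult_mat_vec[of _ m n _ m])
    then have Wx: "transpose_mat W *\<^sub>v ?x = ts ! j" using WW tc[OF ij(2)] by simp
    have xx: "?x \<bullet> ?x = 1"
      using transpose_vec_mult_scalar[OF W tc[OF ij(2)] x] Wx
        orthonormal_nth[OF ts(1), of j j] ts(2) ij(2) by simp
    have "\<forall>l<m - Suc j. qs ! l \<bullet> ?x = 0"
    proof (intro allI impI)
      fix l assume l: "l < m - Suc j"
      show "qs ! l \<bullet> ?x = 0"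
        using transpose_vec_mult_scalar[OF W tc[OF ij(2)] qc[of l]] l mn tq ij(2) by simp
    qed
    then have "(A *\<^sub>v ?x) \<bullet> (A *\<^sub>v ?x) \<le> (singular_value A (Suc (m - Suc j)))\<^sup>2"
      using bound[of "m - Suc j" ?x] x xx ij mn by simp
    moreover have "(us ! i \<bullet> (A *\<^sub>v ?x))\<^sup>2 \<le> (A *\<^sub>v ?x) \<bullet> (A *\<^sub>v ?x)"
      using orthonormal_nth[OF us(1), of i i] us(2) ij(1)
      by (intro scalar_prod_le_unit[OF uc[OF ij(1)] mult_mat_vec_carrier[OF A x]]) simp
    ultimately have "(us ! i \<bullet> (A *\<^sub>v ?x))\<^sup>2 \<le> (singular_value A (Suc (m - Suc j)))\<^sup>2" by linarith
    moreover have "singular_value A (Suc (m - Suc j)) \<ge> 0" using sv ij mn by simp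
    ultimately show ?thesis unfolding entry[OF ij] by (metis abs_le_square_iff abs_of_nonneg)
  qed
  then have "\<bar>det (?M * T)\<bar> \<le> fact m * (\<Prod>j<m. singular_value A (Suc (m - Suc j)))"
    using mult_carrier_mat[OF M T] by (intro abs_det_le_fact_mult_prod)
  \<comment> \<open>The columns of \<open>?M * T\<close> meet the singular values in reverse
    order.\<close>
  also have "(\<Prod>j<m. singular_value A (Suc (m - Suc j))) = (\<Prod>j<m. singular_value A (Suc j))"
    by (rule prod.nat_diff_reindex)
  also have "\<bar>det (?M * T)\<bar> = \<bar>det ?M\<bar>"
    using det_mult[OF M T] abs_det_orthogonal[OF T TT] by (simp add: abs_mult)
  finally show ?thesis .
qed

section \<open>Arnoldi vectors and the Hessenberg structure\<close>

text \<open>Each step only appends a vector, so \<open>arnoldi_vec A b j\<close> does not depend on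
  when the process is stopped. This gives a uniform recursion in place of the three defining
  clauses.\<close>

lemma arnoldi_Suc: "arnoldi A b (Suc m) = arnoldi A b m @ [arnoldi_vec A b (Suc m)]"
proof -
  have len: "length (arnoldi A b j) = j" for j
    by (induction A b j rule: arnoldi.induct) (auto simp: Let_def)
  show ?thesis
    by (cases m) (auto simp: arnoldi_vec_def Let_def nth_append len[of "Suc _", simplified])
qed

lemma arnoldi_eq_map: "arnoldi A b m = map (\<lambda>i. arnoldi_vec A b (Suc i)) [0..<m]"
  by (induction m) (simp_all add: arnoldi_Suc)

lemma arnoldi_vec_1: "arnoldi_vec A b (Suc 0) = vec_unit b"
  by (simp add: arnoldi_vec_def)

lemma arnoldi_vec_Suc_Suc:
  "arnoldi_vec A b (Suc (Suc j)) =
    vec_unit (orth_residual (arnoldi A b (Suc j)) (A *\<^sub>v arnoldi_vec A b (Suc j)))"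
proof -
  have "last (arnoldi A b (Suc j)) = arnoldi_vec A b (Suc j)"
    by (simp add: arnoldi_Suc del: arnoldi.simps)
  moreover have "arnoldi_vec A b (Suc (Suc j)) = last (arnoldi A b (Suc (Suc j)))"
    by (simp add: arnoldi_Suc del: arnoldi.simps)
  ultimately show ?thesis by (simp add: Let_def)
qed

text \<open>For orthonormal \<open>ws\<close> the residual is \<open>v\<close> minus its orthogonal
  projection onto their span. The third claim says that a vector orthogonal to that span cannot
  distinguish \<open>v\<close> from its residual; it yields the vanishing Hessenberg
  entries.\<close>

lemma
  assumes ws: "orthonormal n ws" and v: "v \<in> carrier_vec n"
  shows orth_residual_carrier: "orth_residual ws v \<in> carrier_vec n"
    and orth_residual_orthogonal: "w \<in> set ws \<Longrightarrow> w \<bullet> orth_residual ws v = 0"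
    and scalar_prod_orth_residual:
      "u \<in> carrier_vec n \<Longrightarrow> \<forall>w\<in>set ws. w \<bullet> u = 0 \<Longrightarrow> u \<bullet> orth_residual ws v = u \<bullet> v"
proof -
  define W where "W = mat_of_cols n ws"
  let ?m = "length ws"
  have W: "W \<in> carrier_mat n ?m" by (simp add: W_def)
  have WT: "transpose_mat W \<in> carrier_mat ?m n" using W by simp
  have WW: "transpose_mat W * W = 1\<^sub>m ?m"
    unfolding W_def by (rule orthonormal_transpose_mult[OF ws])
  let ?c = "transpose_mat W *\<^sub>v v"
  have c: "?c \<in> carrier_vec ?m" using WT v by (rule mult_mat_vec_carrier)
  have Wc: "W *\<^sub>v ?c \<in> carrier_vec n" using W c by (rule mult_mat_vec_carrier)
  have r: "orth_residual ws v = v - W *\<^sub>v ?c"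
    using v by (simp add: orth_residual_def W_def Let_def)
  show "orth_residual ws v \<in> carrier_vec n" unfolding r using v Wc by simp
  have sp: "u \<bullet> orth_residual ws v = u \<bullet> v - (transpose_mat W *\<^sub>v u) \<bullet> ?c"
    if u: "u \<in> carrier_vec n" for u
    unfolding r scalar_prod_minus_distrib[OF u v Wc] transpose_vec_mult_scalar[OF W c u] ..
  have Wu: "(transpose_mat W *\<^sub>v u) $ i = ws ! i \<bullet> u" if "i < ?m" for u i
    using that orthonormal_carrier[OF ws] by (simp add: W_def)
  {
    assume "u \<in> carrier_vec n" "\<forall>w\<in>set ws. w \<bullet> u = 0"
    moreover from this have "transpose_mat W *\<^sub>v u = 0\<^sub>v ?m"
      using W Wu by (intro eq_vecI) auto
    ultimately show "u \<bullet> orth_residual ws v = u \<bullet> v" using sp c by simp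
  }
  {
    assume "w \<in> set ws"
    then obtain i where i: "i < ?m" "w = ws ! i" by (auto simp: in_set_conv_nth)
    have w: "w \<in> carrier_vec n" using i orthonormal_carrier[OF ws] by simp
    have "transpose_mat W *\<^sub>v w = unit_vec ?m i"
      using W Wu i orthonormal_nth[OF ws _ i(1)] by (intro eq_vecI) auto
    then show "w \<bullet> orth_residual ws v = 0"
      using sp[OF w] i c Wu[of i v] by simp
  }
qed

lemma vec_unit_zero [simp]: "vec_unit (0\<^sub>v n) = 0\<^sub>v n"
  by (intro eq_vecI) (auto simp: vec_unit_def)

lemma orthonormal_arnoldi:
  assumes A: "A \<in> carrier_mat n n" and b: "b \<in> carrier_vec n"
    and nz: "\<forall>i<m. arnoldi_vec A b (Suc i) \<noteq> 0\<^sub>v n"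
  shows "orthonormal n (arnoldi A b m)"
  using nz
proof (induction m)
  case 0
  then show ?case by (simp add: orthonormal_def)
next
  case (Suc m)
  then have ws: "orthonormal n (arnoldi A b m)" by simp
  show ?case
  proof (cases m)
    case 0
    then have "b \<noteq> 0\<^sub>v n" using Suc.prems by (auto simp: arnoldi_vec_1)
    then show ?thesis using scalar_prod_vec_unit[OF b] 0 by (simp add: orthonormal_def)
  next
    case (Suc j)
    let ?v = "A *\<^sub>v arnoldi_vec A b m"
    let ?r = "orth_residual (arnoldi A b m) ?v"
    have "arnoldi_vec A b m \<in> carrier_vec n"
      using ws Suc by (auto simp: orthonormal_def arnoldi_eq_map)
    then have v: "?v \<in> carrier_vec n" by (rule mult_mat_vec_carrier[OF A])
    note r = orth_residual_carrier[OF ws v]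
    have new: "arnoldi_vec A b (Suc m) = vec_unit ?r" unfolding Suc by (rule arnoldi_vec_Suc_Suc)
    \<comment> \<open>A zero residual would be normalised to the zero vector, which the hypothesis
      excludes.\<close>
    have "?r \<noteq> 0\<^sub>v n" using Suc.prems new by fastforce
    note unit = scalar_prod_vec_unit[OF r this]
    have "w \<bullet> vec_unit ?r = 0" if w: "w \<in> set (arnoldi A b m)" for w
    proof -
      have "w \<in> carrier_vec n" using w ws by (auto simp: orthonormal_def)
      then show ?thesis
        using orth_residual_orthogonal[OF ws v w] r by (simp add: vec_unit_def)
    qed
    then show ?thesis unfolding arnoldi_Suc new using unit by (intro orthonormal_snoc[OF ws]) auto
  qed
qed

text \<open>The vector with number \<open>i\<close> is orthogonal to the first \<open>Suc j\<close>
  Arnoldi vectors, so its product with \<open>?v\<close> equals its product with the residual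
  \<open>?r\<close>. The latter is a multiple of the vector with number \<open>Suc (Suc j)\<close>,
  to which it is orthogonal as well.\<close>

lemma hessenberg_eq_0:
  assumes A: "A \<in> carrier_mat n n" and on: "orthonormal n (arnoldi A b m)"
    and ij: "Suc (Suc j) < i" "i \<le> m"
  shows "hessenberg A b i (Suc j) = 0"
proof -
  have all: "arnoldi_vec A b (Suc k) \<in> carrier_vec n" if "k < m" for k
    using on that by (auto simp: orthonormal_def arnoldi_eq_map)
  have orth: "arnoldi_vec A b (Suc k) \<bullet> arnoldi_vec A b (Suc l) = (if k = l then 1 else 0)"
    if "k < m" "l < m" for k l
    using orthonormal_nth[OF on, of k l] that by (simp add: arnoldi_eq_map)
  obtain i' where i': "i = Suc i'" using ij(1) by (cases i) auto
  let ?ws = "arnoldi A b (Suc j)"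
  have pre: "?ws = take (Suc j) (arnoldi A b m)"
    using ij by (simp add: arnoldi_eq_map take_map del: arnoldi.simps)
  have ws: "orthonormal n ?ws"
    unfolding pre by (rule orthonormal_take[OF on])
  let ?v = "A *\<^sub>v arnoldi_vec A b (Suc j)"
  let ?r = "orth_residual ?ws ?v"
  let ?u = "arnoldi_vec A b i"
  have v: "?v \<in> carrier_vec n" using all[of j] ij by (intro mult_mat_vec_carrier[OF A]) simp
  have u: "?u \<in> carrier_vec n" using all[of i'] ij i' by simp
  have r: "?r \<in> carrier_vec n" by (rule orth_residual_carrier[OF ws v])
  have "\<forall>w\<in>set ?ws. w \<bullet> ?u = 0"
    using orth ij i' by (auto simp: arnoldi_eq_map simp del: arnoldi.simps)
  from scalar_prod_orth_residual[OF ws v u this]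
  have "hessenberg A b i (Suc j) = ?u \<bullet> ?r" by (simp add: hessenberg_def)
  moreover have "?u \<bullet> vec_unit ?r = 0"
    unfolding arnoldi_vec_Suc_Suc[symmetric] using orth[of i' "Suc j"] ij i' by simp
  \<comment> \<open>Cancelling the factor of \<open>vec_unit\<close> is only possible if the norm is
    nonzero; otherwise \<open>?r\<close> itself vanishes.\<close>
  then have "?u \<bullet> ?r = 0 \<or> vec_norm2 ?r = 0" using u r by (simp add: vec_unit_def)
  moreover have "?u \<bullet> ?r = 0" if "vec_norm2 ?r = 0"
  proof -
    have "?r = 0\<^sub>v n" using that scalar_prod_self_eq_0_iff[OF r] by (simp add: vec_norm2_def)
    then show ?thesis using u by simp
  qed
  ultimately show ?thesis by argo
qed

text \<open>A nonzero product means that no breakdown has occurred through step \<open>m\<close>, so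
  the first \<open>Suc m\<close> Arnoldi vectors are orthonormal and the determinant bound applies
  to two shifted lists of \<open>m\<close> of them.\<close>

lemma prod_hessenberg_le:
  assumes A: "A \<in> carrier_mat n n" and b: "b \<in> carrier_vec n" "b \<noteq> 0\<^sub>v n"
    and nz: "(\<Prod>i=1..m. hessenberg A b (i + 1) i) \<noteq> 0"
  shows "m \<le> n"
    and "(\<Prod>i=1..m. hessenberg A b (i + 1) i) \<le> fact m * (\<Prod>j<m. singular_value A (Suc j))"
proof -
  let ?w = "arnoldi_vec A b"
  \<comment> \<open>Only dimensions are compared, because orthonormality is not yet available at
    this point.\<close>
  have wc: "?w (Suc i) \<in> carrier_vec n" for i
  proof (induction i)
    case 0
    then show ?case using b by (simp add: arnoldi_vec_1 vec_unit_def)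
  next
    case (Suc i)
    have "dim_vec (A *\<^sub>v ?w (Suc i)) = n" using A by simp
    then have "orth_residual (arnoldi A b (Suc i)) (A *\<^sub>v ?w (Suc i)) \<in> carrier_vec n"
      unfolding orth_residual_def Let_def by (intro carrier_vecI) simp
    then show ?case by (simp add: arnoldi_vec_Suc_Suc vec_unit_def del: arnoldi.simps)
  qed
  \<comment> \<open>For positive \<open>i\<close> this vector is the left factor of a subdiagonal
    entry, and that entry is nonzero.\<close>
  have "?w (Suc i) \<noteq> 0\<^sub>v n" if i: "i < Suc m" for i
  proof (cases i)
    case 0
    then show ?thesis using scalar_prod_vec_unit[OF b] by (auto simp: arnoldi_vec_1)
  next
    case (Suc j)
    then have "hessenberg A b (Suc i) i \<noteq> 0" using nz i by (auto simp: prod_zero_iff)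
    moreover have "A *\<^sub>v ?w i \<in> carrier_vec n"
      unfolding Suc by (rule mult_mat_vec_carrier[OF A wc])
    ultimately show ?thesis by (auto simp: hessenberg_def)
  qed
  then have on: "orthonormal n (arnoldi A b (Suc m))"
    by (intro orthonormal_arnoldi[OF A b(1)]) blast
  let ?ws = "arnoldi A b m"
  let ?us = "tl (arnoldi A b (Suc m))"
  have us: "?us = map (\<lambda>i. ?w (Suc (Suc i))) [0..<m]"
    unfolding arnoldi_eq_map by (simp only: map_tl[symmetric] tl_upt)
      (simp only: map_Suc_upt[symmetric] map_map o_def)
  have ws: "?ws = map (\<lambda>i. ?w (Suc i)) [0..<m]" by (rule arnoldi_eq_map)
  have on_ws: "orthonormal n ?ws"
    using on unfolding orthonormal_def arnoldi_Suc by simp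
  have on_us: "orthonormal n ?us" by (rule orthonormal_tl[OF on])
  show "m \<le> n" using orthonormal_length_le[OF on_ws] by (simp add: ws)
  \<comment> \<open>Dropping the first Arnoldi vector on the left moves the subdiagonal of the
    Hessenberg matrix onto the diagonal, which leaves an upper triangular matrix.\<close>
  let ?M = "mat m m (\<lambda>(i, j). ?us ! i \<bullet> (A *\<^sub>v ?ws ! j))"
  have entry: "?M $$ (i, j) = hessenberg A b (Suc (Suc i)) (Suc j)" if "i < m" "j < m" for i j
    using that by (simp add: us ws hessenberg_def del: arnoldi.simps)
  have "det ?M = prod_list (diag_mat ?M)"
  proof (rule det_upper_triangular[of _ m])
    show "upper_triangular ?M"
    proof (rule upper_triangularI)
      fix i j assume "j < i" "i < dim_row ?M"
      then show "?M $$ (i, j) = 0"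
        using hessenberg_eq_0[OF A on, of j "Suc (Suc i)"] entry by simp
    qed
  qed simp
  also have "\<dots> = (\<Prod>i<m. hessenberg A b (Suc (Suc i)) (Suc i))"
    unfolding diag_mat_def prod.list_conv_set_nth
    by (auto simp: entry atLeast0LessThan intro!: prod.cong simp del: index_mat)
  also have "\<dots> = (\<Prod>i=1..m. hessenberg A b (i + 1) i)"
    by (rule prod.reindex_bij_witness[of _ "\<lambda>i. i - 1" Suc]) auto
  finally have "det ?M = (\<Prod>i=1..m. hessenberg A b (i + 1) i)" .
  moreover have "\<bar>det ?M\<bar> \<le> fact m * (\<Prod>j<m. singular_value A (Suc j))"
    by (rule abs_det_compression_le[OF A on_us _ on_ws]) (simp_all add: us ws)
  ultimately show "(\<Prod>i=1..m. hessenberg A b (i + 1) i) \<le> fact m * (\<Prod>j<m. singular_value A (Suc j))"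
    by linarith
qed

section \<open>Asymptotic estimate and conclusion\<close>

text \<open>With m! at most m^m, the m-th root is at most m times the geometric mean of the decay
  bounds, that is \<open>D * m * exp (- \<alpha> * (m + 1) / 2)\<close>. Half of the exponential
  decay is spent on absorbing the factor m.\<close>

lemma fact_mult_prod_exp_le:
  fixes \<alpha> D :: real and s :: "nat \<Rightarrow> real"
  assumes \<alpha>: "\<alpha> > 0" and D: "D > 0"
    and s: "\<And>j. j < m \<Longrightarrow> 0 \<le> s j \<and> s j \<le> D * exp (- \<alpha> * real (Suc j))"
  shows "fact m * (\<Prod>j<m. s j) \<le> (D * (4 / \<alpha>) * exp (- (\<alpha> * real m / 4)))^m"
proof -
  have "(\<Prod>j<m. s j) \<le> (\<Prod>j<m. D * exp (- \<alpha> * real (Suc j)))"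
    using s by (intro prod_mono) auto
  also have "\<dots> = D ^ m * exp (- (\<alpha> * (\<Sum>j<m. real (Suc j))))"
    by (simp add: prod.distrib exp_sum sum_negf sum_distrib_left flip: exp_sum)
  also have "(\<Sum>j<m. real (Suc j)) = real m * (real m + 1) / 2"
    by (induction m) (simp_all add: field_simps)
  also have "exp (- (\<alpha> * (real m * (real m + 1) / 2))) = exp (- (\<alpha> * (real m + 1) / 2)) ^ m"
    by (simp add: exp_of_nat_mult[symmetric] field_simps)
  finally have P: "(\<Prod>j<m. s j) \<le> (D * exp (- (\<alpha> * (real m + 1) / 2))) ^ m"
    by (simp add: power_mult_distrib)
  have "fact m * (\<Prod>j<m. s j) \<le> real m ^ m * (D * exp (- (\<alpha> * (real m + 1) / 2))) ^ m"
    using P s fact_le_power[of m, where 'a = real] by (intro mult_mono prod_nonneg) auto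
  also have "\<dots> = (D * (real m * exp (- (\<alpha> * (real m + 1) / 2)))) ^ m"
    by (simp add: power_mult_distrib)
  also have "\<dots> \<le> (D * (4 / \<alpha> * exp (- (\<alpha> * real m / 4)))) ^ m"
  proof (intro power_mono mult_left_mono)
    \<comment> \<open>The inequality x \<le> exp x at x = \<alpha> m / 4 is the source of the
      constant \<open>4 / \<alpha>\<close>.\<close>
    have "\<alpha> * real m / 4 \<le> exp (\<alpha> * real m / 4)" using exp_ge_add_one_self[of "\<alpha> * real m / 4"] by linarith
    then have "real m \<le> 4 / \<alpha> * exp (\<alpha> * real m / 4)" using \<alpha> by (simp add: field_simps)
    then have "real m * exp (- (\<alpha> * (real m + 1) / 2))
        \<le> (4 / \<alpha> * exp (\<alpha> * real m / 4)) * exp (- (\<alpha> * (real m + 1) / 2))"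
      by (rule mult_right_mono) simp
    also have "\<dots> = 4 / \<alpha> * exp (\<alpha> * real m / 4 + - (\<alpha> * (real m + 1) / 2))"
      by (simp only: mult.assoc exp_add)
    also have "\<dots> \<le> 4 / \<alpha> * exp (- (\<alpha> * real m / 4))"
      using \<alpha> by (intro mult_left_mono) (auto simp: field_simps)
    finally show "real m * exp (- (\<alpha> * (real m + 1) / 2)) \<le> 4 / \<alpha> * exp (- (\<alpha> * real m / 4))" .
  qed (use D in auto)
  finally show ?thesis by (simp add: mult.assoc)
qed

text \<open>From e \<ge> 2 the rate 1/e^2 is at most 1/4, and the additional constant in the
  exponent is positive.\<close>

lemma exp_quarter_le:
  fixes \<alpha> :: real
  assumes "\<alpha> > 0"
  shows "exp (- (\<alpha> * real m / 4)) \<le> exp (- (real m * \<alpha>) / (exp 1)\<^sup>2 + (\<alpha> + 2) / 2)"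
proof -
  have "(2::real) \<le> exp 1" using exp_ge_add_one_self[of "1::real"] by simp
  then have "(2::real)\<^sup>2 \<le> (exp 1)\<^sup>2" by (rule power_mono) simp
  define t where "t = real m * \<alpha> / (exp 1)\<^sup>2"
  define p where "p = \<alpha> * real m / 4"
  have "t \<le> real m * \<alpha> / 4"
    unfolding t_def using assms \<open>2\<^sup>2 \<le> (exp 1)\<^sup>2\<close> by (intro divide_left_mono) auto
  then have "t \<le> p" by (simp add: p_def mult.commute)
  then have "- p \<le> - t + (\<alpha> + 2) / 2" using assms by (simp add: field_simps)
  moreover have "- (real m * \<alpha>) / (exp 1)\<^sup>2 = - t" by (simp add: t_def)
  ultimately show ?thesis unfolding p_def by (simp only: exp_le_cancel_iff)
qed

theorem proposition2:
  fixes \<alpha> C :: real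
  assumes "\<alpha> > 0"
  shows "\<exists>k > 0. \<exists>\<epsilon> :: nat \<Rightarrow> real. \<epsilon> \<in> O(\<lambda>m. 1 / real m) \<and>
    (\<forall>\<^sub>F m in sequentially. \<forall>(N :: nat) (A :: real mat) (b :: real vec).
       A \<in> carrier_mat N N \<longrightarrow> b \<in> carrier_vec N \<longrightarrow> b \<noteq> 0\<^sub>v N \<longrightarrow>
       (\<forall>j\<in>{1..N}. singular_value A j \<le> C * exp (- \<alpha> * real j)) \<longrightarrow>
       root m (\<Prod>i=1..m. hessenberg A b (i + 1) i)
         \<le> k * exp (- (real m * \<alpha>) / (exp 1)\<^sup>2 + (\<alpha> + 2) / 2 + \<epsilon> m))"
proof -
  \<comment> \<open>\<open>C\<close> may be zero or negative, whereas \<open>k\<close> has to be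
    positive. Both \<open>D\<close> and \<open>k\<close> depend on \<open>\<alpha>\<close> and
    \<open>C\<close> alone, hence the bound is uniform in \<open>N\<close>, \<open>A\<close> and
    \<open>b\<close>.\<close>
  define D where "D = \<bar>C\<bar> + 1"
  define k where "k = D * (4 / \<alpha>)"
  have D: "D > 0" "C \<le> D" by (auto simp: D_def)
  have k: "k > 0" using D assms by (simp add: k_def)
  have bound: "root m (\<Prod>i=1..m. hessenberg A b (i + 1) i)
      \<le> k * exp (- (real m * \<alpha>) / (exp 1)\<^sup>2 + (\<alpha> + 2) / 2)"
    if m: "m > 0" and A: "A \<in> carrier_mat N N" and b: "b \<in> carrier_vec N" "b \<noteq> 0\<^sub>v N"
      and decay: "\<forall>j\<in>{1..N}. singular_value A j \<le> C * exp (- \<alpha> * real j)"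
    for m N :: nat and A :: "real mat" and b :: "real vec"
  proof (cases "(\<Prod>i=1..m. hessenberg A b (i + 1) i) = 0")
    \<comment> \<open>This is the case of breakdown, which covers every \<open>m\<close> beyond
      \<open>N\<close>; the root of 0 is 0.\<close>
    case True
    show ?thesis unfolding True using k by simp
  next
    case False
    \<comment> \<open>This keeps the indices up to \<open>m\<close> within 1..N, where the singular
      values are genuine list entries and the decay hypothesis holds.\<close>
    have mN: "m \<le> N" by (rule prod_hessenberg_le(1)[OF A b False])
    have s: "0 \<le> singular_value A (Suc j) \<and>
        singular_value A (Suc j) \<le> D * exp (- \<alpha> * real (Suc j))" if j: "j < m" for j
    proof
      show "0 \<le> singular_value A (Suc j)" using singular_value_bound[OF A] j mN by auto
      have "singular_value A (Suc j) \<le> C * exp (- \<alpha> * real (Suc j))"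
        by (rule bspec[OF decay]) (use j mN in auto)
      also have "\<dots> \<le> D * exp (- \<alpha> * real (Suc j))" using D by (intro mult_right_mono) auto
      finally show "singular_value A (Suc j) \<le> D * exp (- \<alpha> * real (Suc j))" .
    qed
    have "(\<Prod>i=1..m. hessenberg A b (i + 1) i) \<le> fact m * (\<Prod>j<m. singular_value A (Suc j))"
      by (rule prod_hessenberg_le(2)[OF A b False])
    also have "\<dots> \<le> (k * exp (- (\<alpha> * real m / 4))) ^ m"
      unfolding k_def by (rule fact_mult_prod_exp_le[OF assms D(1) s])
    finally have "root m (\<Prod>i=1..m. hessenberg A b (i + 1) i)
        \<le> root m ((k * exp (- (\<alpha> * real m / 4))) ^ m)"
      using m by (intro real_root_le_mono)
    also have "\<dots> = k * exp (- (\<alpha> * real m / 4))"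
      using m k by (intro real_root_power_cancel) auto
    also have "\<dots> \<le> k * exp (- (real m * \<alpha>) / (exp 1)\<^sup>2 + (\<alpha> + 2) / 2)"
      using k exp_quarter_le[OF assms] by (intro mult_left_mono) auto
    finally show ?thesis .
  qed
  show ?thesis
  proof (rule exI[of _ k], rule conjI[OF k], rule exI[of _ "\<lambda>m. 0"], rule conjI)
    show "(\<lambda>m. 0 :: real) \<in> O(\<lambda>m. 1 / real m)" by simp
    show "\<forall>\<^sub>F m in sequentially. \<forall>(N :: nat) (A :: real mat) (b :: real vec).
       A \<in> carrier_mat N N \<longrightarrow> b \<in> carrier_vec N \<longrightarrow> b \<noteq> 0\<^sub>v N \<longrightarrow>
       (\<forall>j\<in>{1..N}. singular_value A j \<le> C * exp (- \<alpha> * real j)) \<longrightarrow>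
       root m (\<Prod>i=1..m. hessenberg A b (i + 1) i)
         \<le> k * exp (- (real m * \<alpha>) / (exp 1)\<^sup>2 + (\<alpha> + 2) / 2 + 0)"
      \<comment> \<open>Positivity of \<open>m\<close> suffices; it is what makes
        \<open>root m\<close> monotone and inverse to the m-th power on nonnegative numbers.\<close>
      using eventually_gt_at_top[of "0::nat"]
      by (rule eventually_mono) (intro allI impI, unfold add_0_right, rule bound)
  qed
qed

end
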